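(* Let $X$ be a $B$-term and $T$ a set of $B$-terms such that $X_{(i)}\in T$ for all $i\ge1$ (up to $\beta\eta$-equivalence) and $l(X)-a(X')\ge1$ for every $X'\in T$. Then $X$ does not have the $\rho$-property.
   Context: $B=\lambda f.\lambda g.\lambda x.\, f\,(g\,x)$; $B$-terms are combinatory terms built from $B$ by application. Every $B$-term $Y$ has a $\beta\eta$-normal form $\lambda x_1.\cdots\lambda x_n.\,x_1\,e_1\cdots e_k$ with $e_1,\dots,e_k$ built from variables by application; define $l(Y)=n$ and $a(Y)=k$. For a term $X$ and $k\ge1$, $X_{(k)}$ denotes $X\,X\cdots X$ ($k$ copies, left-associated). $X$ has the $\rho$-property if there are distinct positive integers $i,j$ with $X_{(i)}$ and $X_{(j)}$ $\beta\eta$-equivalent. *)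

theory Defs
  imports Main
begin

text \<open>Untyped lambda terms with de Bruijn indices (\<open>Var 0\<close> refers to the innermost binder).\<close>

datatype lterm = Var nat | App lterm lterm | Abs lterm

primrec lift :: "lterm \<Rightarrow> nat \<Rightarrow> lterm" where
  "lift (Var i) c = (if i < c then Var i else Var (Suc i))"
| "lift (App s t) c = App (lift s c) (lift t c)"
| "lift (Abs t) c = Abs (lift t (Suc c))"

text \<open>\<open>subst t s c\<close> replaces index \<open>c\<close> by \<open>s\<close> and lowers the indices above \<open>c\<close>, since it is
  used to contract a redex whose binder disappears.\<close>

primrec subst :: "lterm \<Rightarrow> lterm \<Rightarrow> nat \<Rightarrow> lterm" where
  "subst (Var i) s c = (if i < c then Var i else if i = c then s else Var (i - 1))"
| "subst (App t u) s c = App (subst t s c) (subst u s c)"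
| "subst (Abs t) s c = Abs (subst t (lift s 0) (Suc c))"

text \<open>In the eta rule, \<open>lift t 0\<close> expresses that the bound variable does not occur in the
  function part.\<close>

inductive beta_eta :: "lterm \<Rightarrow> lterm \<Rightarrow> bool" where
  beta: "beta_eta (App (Abs s) t) (subst s t 0)"
| eta: "beta_eta (Abs (App (lift t 0) (Var 0))) t"
| appL: "beta_eta s s' \<Longrightarrow> beta_eta (App s t) (App s' t)"
| appR: "beta_eta t t' \<Longrightarrow> beta_eta (App s t) (App s t')"
| abs: "beta_eta t t' \<Longrightarrow> beta_eta (Abs t) (Abs t')"

abbreviation beta_eta_equiv :: "lterm \<Rightarrow> lterm \<Rightarrow> bool" where
  "beta_eta_equiv \<equiv> equivclp beta_eta"

definition beta_eta_normal :: "lterm \<Rightarrow> bool" where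
  "beta_eta_normal t \<longleftrightarrow> (\<nexists>u. beta_eta t u)"

datatype bterm = B | BApp bterm bterm

primrec to_lterm :: "bterm \<Rightarrow> lterm" where
  "to_lterm B = Abs (Abs (Abs (App (Var 2) (App (Var 1) (Var 0)))))"
| "to_lterm (BApp X Y) = App (to_lterm X) (to_lterm Y)"

definition bterm_equiv :: "bterm \<Rightarrow> bterm \<Rightarrow> bool" where
  "bterm_equiv X Y \<longleftrightarrow> beta_eta_equiv (to_lterm X) (to_lterm Y)"

text \<open>Terms built by application alone from the variables with index below \<open>n\<close>, i.e. from
  \<open>x\<^sub>1, \<dots>, x\<^sub>n\<close> when placed under \<open>n\<close> binders.\<close>

inductive var_app :: "nat \<Rightarrow> lterm \<Rightarrow> bool" for n where
  "i < n \<Longrightarrow> var_app n (Var i)"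
| "var_app n s \<Longrightarrow> var_app n t \<Longrightarrow> var_app n (App s t)"

text \<open>\<open>head_form n [e\<^sub>1, \<dots>, e\<^sub>k]\<close> is \<open>\<lambda>x\<^sub>1. \<dots> \<lambda>x\<^sub>n. x\<^sub>1 e\<^sub>1 \<dots> e\<^sub>k\<close> (for \<open>n \<ge> 1\<close>); the outermost
  variable \<open>x\<^sub>1\<close> has de Bruijn index \<open>n - 1\<close>.\<close>

definition head_form :: "nat \<Rightarrow> lterm list \<Rightarrow> lterm" where
  "head_form n es = (Abs ^^ n) (foldl App (Var (n - 1)) es)"

definition has_nf :: "bterm \<Rightarrow> nat \<Rightarrow> lterm list \<Rightarrow> bool" where
  "has_nf Y n es \<longleftrightarrow> n \<ge> 1 \<and> (\<forall>e \<in> set es. var_app n e) \<and>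
     beta_eta_normal (head_form n es) \<and> beta_eta_equiv (to_lterm Y) (head_form n es)"

text \<open>\<open>num_binders Y\<close> is \<open>l(Y)\<close> and \<open>num_args Y\<close> is \<open>a(Y)\<close>. Every \<open>B\<close>-term has exactly one
  beta-eta-normal form, and it has the above shape.\<close>

definition num_binders :: "bterm \<Rightarrow> nat" where
  "num_binders Y = (THE n. \<exists>es. has_nf Y n es)"

definition num_args :: "bterm \<Rightarrow> nat" where
  "num_args Y = (THE k. \<exists>n es. has_nf Y n es \<and> length es = k)"

text \<open>\<open>self_app X k\<close> is \<open>X\<^sub>(\<^sub>k\<^sub>) = X X \<dots> X\<close> with \<open>k\<close> copies of \<open>X\<close>, and is meaningful only for
  \<open>k \<ge> 1\<close>.\<close>

definition self_app :: "bterm \<Rightarrow> nat \<Rightarrow> bterm" where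
  "self_app X k = foldl BApp X (replicate (k - 1) X)"

definition rho_property :: "bterm \<Rightarrow> bool" where
  "rho_property X \<longleftrightarrow>
     (\<exists>i j. i \<ge> 1 \<and> j \<ge> 1 \<and> i \<noteq> j \<and> bterm_equiv (self_app X i) (self_app X j))"

end

theory Submission imports Defs "HOL-Library.Confluence" begin

text \<open>The normal form of a \<open>B\<close>-term uses its variables once each and from left to right, so it is
  determined by the shape of a binary tree. Write \<open>m = l(X)\<close> and
  \<open>X\<^sub>(\<^sub>i\<^sub>) = \<lambda>x\<^sub>1 \<dots> x\<^sub>n. x\<^sub>1 e\<^sub>1 \<dots> e\<^sub>k\<close> with \<open>k < m\<close>. Then
  \<open>X\<^sub>(\<^sub>i\<^sub>+\<^sub>1\<^sub>) = \<lambda>x\<^sub>2 \<dots> x\<^sub>n. X e\<^sub>1 \<dots> e\<^sub>k\<close> has \<open>n - 1 + m - k \<ge> n\<close> binders. If the sequence repeats,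
  the number of binders is eventually constant, hence eventually \<open>k = m - 1\<close>. The arguments of
  \<open>X\<^sub>(\<^sub>i\<^sub>+\<^sub>1\<^sub>)\<close> are those of \<open>e\<^sub>1\<close> followed by \<open>a(X)\<close> others, and \<open>a(X) \<le> m - 2\<close>, so \<open>e\<^sub>1\<close> has at least
  one argument, and the first argument of \<open>X\<^sub>(\<^sub>i\<^sub>+\<^sub>1\<^sub>)\<close> is a proper subterm of \<open>e\<^sub>1\<close>: an infinite descent.\<close>

section \<open>Confluence of beta-eta reduction\<close>

lemma lift_lift: "i \<le> k \<Longrightarrow> lift (lift t i) (Suc k) = lift (lift t k) i"
  by (induction t arbitrary: i k) auto

lemma subst_lift [simp]: "subst (lift t k) s k = t"
  by (induction t arbitrary: k s) auto

lemma lift_subst_le: "i \<le> k \<Longrightarrow> lift (subst t s i) k = subst (lift t (Suc k)) (lift s k) i"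
  by (induction t arbitrary: i k s) (auto simp: lift_lift)

lemma lift_subst_ge: "k \<le> i \<Longrightarrow> lift (subst t s i) k = subst (lift t k) (lift s k) (Suc i)"
  by (induction t arbitrary: i k s) (auto simp: lift_lift)

lemma subst_subst:
  "i \<le> k \<Longrightarrow> subst (subst t u i) v k = subst (subst t (lift v i) (Suc k)) (subst u v k) i"
proof (induction t arbitrary: i k u v)
  case (Var n)
  then show ?case by (cases n) auto
next
  case (Abs t)
  then show ?case using Abs.IH[of "Suc i" "Suc k" "lift u 0" "lift v 0"] by (simp add: lift_lift lift_subst_ge)
qed auto

text \<open>Two liftings with a common value skip two different indices, so both come from one term
  avoiding both. This serves eta redexes, whose function part is itself a lifting.\<close>

lemma lift_eq_lift:
  "lift s (Suc k) = lift t i \<Longrightarrow> i \<le> k \<Longrightarrow> \<exists>w. s = lift w i \<and> t = lift w k"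
proof (induction s arbitrary: k i t)
  case (Var n)
  then obtain m where "t = Var m" by (cases t) (auto split: if_splits)
  with Var have "(n < i \<and> m = n) \<or> (i < n \<and> ((m < k \<and> n = Suc m) \<or> (k < m \<and> n = m)))"
    by (auto split: if_splits)
  then have "Var n = lift (Var (if n < i then n else n - 1)) i \<and> t = lift (Var (if n < i then n else n - 1)) k"
    using \<open>t = Var m\<close> \<open>i \<le> k\<close> by auto
  then show ?case by blast
next
  case (App a b)
  then obtain a' b' where t: "t = App a' b'" by (cases t) (auto split: if_splits)
  then obtain w w' where "a = lift w i" "a' = lift w k" "b = lift w' i" "b' = lift w' k"
    using App.IH(1)[of k a' i] App.IH(2)[of k b' i] App.prems by auto
  then have "App a b = lift (App w w') i \<and> t = lift (App w w') k" using t by simp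
  then show ?case by blast
next
  case (Abs a)
  then obtain a' where t: "t = Abs a'" by (cases t) (auto split: if_splits)
  then obtain w where "a = lift w (Suc i)" "a' = lift w (Suc k)"
    using Abs.IH[of "Suc k" a' "Suc i"] Abs.prems by auto
  then have "Abs a = lift (Abs w) i \<and> t = lift (Abs w) k" using t by simp
  then show ?case by blast
qed

lemma lift_eq_App: "lift s k = App a b \<longleftrightarrow> (\<exists>a' b'. s = App a' b' \<and> a = lift a' k \<and> b = lift b' k)"
  by (cases s) auto

lemma lift_eq_Abs: "lift s k = Abs a \<longleftrightarrow> (\<exists>a'. s = Abs a' \<and> a = lift a' (Suc k))"
  by (cases s) auto

section \<open>Parallel beta-eta reduction and its diamond property\<close>

inductive par :: "lterm \<Rightarrow> lterm \<Rightarrow> bool" where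
  par_Var: "par (Var i) (Var i)"
| par_App: "par s s' \<Longrightarrow> par t t' \<Longrightarrow> par (App s t) (App s' t')"
| par_Abs: "par s s' \<Longrightarrow> par (Abs s) (Abs s')"
| par_beta: "par s s' \<Longrightarrow> par t t' \<Longrightarrow> par (App (Abs s) t) (subst s' t' 0)"
| par_eta: "par t t' \<Longrightarrow> par (Abs (App (lift t 0) (Var 0))) t'"

inductive_cases par_VarE: "par (Var i) u"
inductive_cases par_AppE [consumes 1, case_names App beta]: "par (App s t) u"
inductive_cases par_AbsE [consumes 1, case_names Abs eta]: "par (Abs s) u"

lemma par_refl: "par t t"
  by (induction t) (auto intro: par.intros)

lemma par_lift: "par s s' \<Longrightarrow> par (lift s k) (lift s' k)"
proof (induction arbitrary: k rule: par.induct)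
  case (par_beta s s' t t')
  then show ?case using par.par_beta[of "lift s (Suc k)" "lift s' (Suc k)" "lift t k" "lift t' k"]
    by (simp add: lift_subst_le)
next
  case (par_eta t t')
  then show ?case using par.par_eta[of "lift t k" "lift t' k"] by (simp add: lift_lift)
qed (auto intro: par.intros)

lemma par_subst: "par s s' \<Longrightarrow> par t t' \<Longrightarrow> par (subst s t k) (subst s' t' k)"
proof (induction arbitrary: k t t' rule: par.induct)
  case (par_Abs s s')
  then show ?case by (simp add: par_lift par.par_Abs)
next
  case (par_beta s s' u u')
  have "par (App (Abs (subst s (lift t 0) (Suc k))) (subst u t k))
    (subst (subst s' (lift t' 0) (Suc k)) (subst u' t' k) 0)"
    using par_beta by (intro par.par_beta) (auto intro: par_lift)
  then show ?case by (simp add: subst_subst)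
next
  case (par_eta s s')
  then show ?case using par.par_eta[of "subst s t k" "subst s' t' k"] by (simp add: lift_subst_ge)
qed (auto intro: par.intros par_lift)

text \<open>Reduction creates no free variables; hence a reduct of the function part of an eta redex
  still has the form required for eta.\<close>

lemma par_lift_inv: "par u v \<Longrightarrow> u = lift s k \<Longrightarrow> \<exists>v'. v = lift v' k \<and> par s v'"
proof (induction arbitrary: s k rule: par.induct)
  case (par_Var i)
  then show ?case by (metis par_refl)
next
  case (par_App a a' b b')
  then obtain p q where s: "s = App p q" "a = lift p k" "b = lift q k"
    by (metis lift_eq_App)
  with par_App.IH obtain p' q' where "a' = lift p' k" "par p p'" "b' = lift q' k" "par q q'" by blast
  then have "App a' b' = lift (App p' q') k \<and> par s (App p' q')" using s by (auto intro: par.intros)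
  then show ?case by blast
next
  case (par_Abs a a')
  then obtain p where s: "s = Abs p" "a = lift p (Suc k)"
    by (metis lift_eq_Abs)
  with par_Abs.IH obtain p' where "a' = lift p' (Suc k)" "par p p'" by blast
  then have "Abs a' = lift (Abs p') k \<and> par s (Abs p')" using s by (auto intro: par.intros)
  then show ?case by blast
next
  case (par_beta a a' b b')
  then obtain p q where s: "s = App (Abs p) q" "a = lift p (Suc k)" "b = lift q k"
    by (metis lift_eq_App lift_eq_Abs)
  with par_beta.IH obtain p' q' where "a' = lift p' (Suc k)" "par p p'" "b' = lift q' k" "par q q'" by blast
  then have "subst a' b' 0 = lift (subst p' q' 0) k \<and> par s (subst p' q' 0)"
    using s by (auto intro: par.intros simp: lift_subst_le)
  then show ?case by blast
next
  case (par_eta t t')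
  then obtain p q where s: "s = Abs (App p q)" and p: "lift p (Suc k) = lift t 0"
    and q: "lift q (Suc k) = Var 0"
    by (metis lift_eq_App lift_eq_Abs)
  from q have q: "q = Var 0" by (cases q) (auto split: if_splits)
  from lift_eq_lift[OF p] obtain w where w: "p = lift w 0" "t = lift w k" by auto
  with par_eta.IH obtain w' where "t' = lift w' k" "par w w'" by blast
  then show ?case using s q w by (auto intro: par.intros)
qed

lemma size_lift [simp]: "size (lift t k) = size t"
  by (induction t arbitrary: k) auto

text \<open>For \<open>k = 0\<close>, this computes the beta contraction of
  \<open>App (lift (Abs t) 0) (Var 0)\<close>, the redex sitting inside an eta redex.\<close>

lemma subst_lift_Suc_Var: "subst (lift t (Suc k)) (Var k) k = t"
  by (induction t arbitrary: k) auto

text \<open>\<open>t'\<close> is the complete development of \<open>t\<close>, in the style of Takahashi.\<close>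

lemma par_development: "\<exists>t'. \<forall>u. par t u \<longrightarrow> par u t'"
\<comment> \<open>Structural induction would miss the eta case: there the recursion is on
  \<open>s\<close>, but the subterm is \<open>lift s 0\<close>, which only has the same
  size.\<close>
proof (induction "size t" arbitrary: t rule: less_induct)
  case less
  consider (Var) i where "t = Var i"
    | (beta) s r where "t = App (Abs s) r"
    | (App) s r where "t = App s r" "\<nexists>s'. s = Abs s'"
    | (eta) s where "t = Abs (App (lift s 0) (Var 0))"
    | (Abs) s where "t = Abs s" "\<nexists>s'. s = App (lift s' 0) (Var 0)"
    by (metis lterm.exhaust)
  then show ?case
  proof cases
    case Var
    then show ?thesis by (auto elim: par_VarE intro: par.intros)
  next
    case beta
    from less[of s] less[of r] obtain s' r' where
      IH: "\<And>u. par s u \<Longrightarrow> par u s'" "\<And>u. par r u \<Longrightarrow> par u r'" using beta by auto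
    have "par u (subst s' r' 0)" if "par t u" for u
      using that unfolding beta
    proof (cases rule: par_AppE)
      case (App p r'')
      from App(2) show ?thesis
      proof (cases rule: par_AbsE)
        case (Abs s'')
        then show ?thesis using \<open>u = App p r''\<close> \<open>par r r''\<close> IH by (auto intro: par.intros)
      next
        \<comment> \<open>Overlap of the outer beta redex with an eta step on its function part:
          substituting into \<open>App (lift p 0) (Var 0)\<close> gives \<open>App p r''\<close>, so
          the bound for \<open>s\<close> applies.\<close>
        case (eta q)
        then have "par s (App (lift p 0) (Var 0))" by (auto intro: par_lift par.intros)
        then have "par (subst (App (lift p 0) (Var 0)) r'' 0) (subst s' r' 0)"
          using IH \<open>par r r''\<close> by (intro par_subst)
        then show ?thesis using \<open>u = App p r''\<close> by simp
      qed
    next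
      case beta
      then show ?thesis using IH by (auto intro: par_subst)
    qed
    then show ?thesis by blast
  next
    case App
    from less[of s] less[of r] obtain s' r' where
      "\<And>u. par s u \<Longrightarrow> par u s'" "\<And>u. par r u \<Longrightarrow> par u r'" using App by auto
    then have "par u (App s' r')" if "par t u" for u
      using that App by (auto elim!: par_AppE intro: par.intros)
    then show ?thesis by blast
  next
    case eta
    from less[of s] obtain s' where IH: "\<And>u. par s u \<Longrightarrow> par u s'" using eta by auto
    have "par u s'" if "par t u" for u
      using that unfolding eta
    proof (cases rule: par_AbsE)
      case (Abs v)
      from Abs(2) show ?thesis
      proof (cases rule: par_AppE)
        case (App p q)
        then obtain p' where "p = lift p' 0" "par s p'" using par_lift_inv by blast
        then show ?thesis using \<open>u = Abs v\<close> App IH by (auto elim!: par_VarE intro: par.intros)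
      next
        \<comment> \<open>Overlap of the outer eta redex with a beta step inside: \<open>s\<close>
          is then an abstraction \<open>Abs c\<close>, and both rules lead to reducts of
          \<open>s\<close>.\<close>
        case (beta a a' b)
        then obtain c where c: "s = Abs c" "a = lift c (Suc 0)" by (metis lift_eq_Abs)
        with beta obtain c' where c': "a' = lift c' (Suc 0)" "par c c'" using par_lift_inv by blast
        have "b = Var 0" using beta by (auto elim: par_VarE)
        then have "u = Abs c'" using \<open>u = Abs v\<close> beta c' by (simp add: subst_lift_Suc_Var)
        then show ?thesis using IH c c' by (auto intro: par.intros)
      qed
    next
      case (eta q)
      then have "q = s" by (metis subst_lift lterm.inject(2))
      then show ?thesis using eta IH by simp
    qed
    then show ?thesis by blast
  next
    case Abs
    from less[of s] obtain s' where "\<And>u. par s u \<Longrightarrow> par u s'" using Abs by auto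
    then have "par u (Abs s')" if "par t u" for u
      using that Abs by (auto elim!: par_AbsE intro: par.intros)
    then show ?thesis by blast
  qed
qed

lemma beta_eta_imp_par: "beta_eta s t \<Longrightarrow> par s t"
  by (induction rule: beta_eta.induct) (auto intro: par.intros par_refl)

lemma par_confluent: "confluentp par"
proof (rule strong_confluentp_imp_confluentp, rule strong_confluentpI)
  fix x y z assume "par x y" "par x z"
  then obtain u where "par y u" "par z u" using par_development by blast
  then show "\<exists>u. par\<^sup>*\<^sup>* y u \<and> par\<^sup>=\<^sup>= z u" by blast
qed

section \<open>Uniqueness of normal forms\<close>

lemma normal_AppD: "beta_eta_normal (App s t) \<Longrightarrow> beta_eta_normal s \<and> beta_eta_normal t"
  unfolding beta_eta_normal_def by (blast intro: beta_eta.intros)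

lemma normal_AbsD: "beta_eta_normal (Abs s) \<Longrightarrow> beta_eta_normal s"
  unfolding beta_eta_normal_def by (blast intro: beta_eta.intros)

lemma normal_par: "par s t \<Longrightarrow> beta_eta_normal s \<Longrightarrow> t = s"
proof (induction rule: par.induct)
  case (par_beta s s' t t')
  then show ?case unfolding beta_eta_normal_def by (blast intro: beta_eta.intros)
next
  case (par_eta t t')
  then show ?case unfolding beta_eta_normal_def by (blast intro: beta_eta.intros)
qed (auto dest: normal_AppD normal_AbsD)

lemma normal_par_rtranclp:
  assumes "par\<^sup>*\<^sup>* s t" "beta_eta_normal s"
  shows "t = s"
  using assms by (induction rule: rtranclp_induct) (auto dest: normal_par)

inductive_cases beta_eta_VarE: "beta_eta (Var i) u"
inductive_cases beta_eta_AppE: "beta_eta (App s t) u"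
inductive_cases beta_eta_AbsE: "beta_eta (Abs s) u"

abbreviation equiv_infix (infix "\<approx>" 50) where
  "s \<approx> t \<equiv> beta_eta_equiv s t"

text \<open>\<open>par\<close> contains every beta-eta step, so its confluence joins the two terms,
  and a normal term is its own only parallel reduct.\<close>

lemma normal_form_unique:
  assumes "s \<approx> t" "beta_eta_normal s" "beta_eta_normal t"
  shows "s = t"
proof -
  have "equivclp par s t"
    using assms(1)
  proof (induction rule: equivclp_induct)
    case (step y z)
    then show ?case using beta_eta_imp_par by (meson equivclp_into_equivclp)
  qed simp
  then obtain u where "par\<^sup>*\<^sup>* s u" "par\<^sup>*\<^sup>* t u"
    using semiconfluentp_equivclp par_confluent
    by (metis (no_types, lifting) confluentp_eq_semiconfluentp conversepD relcompp.cases rtranclp_conversep)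
  then show ?thesis using assms normal_par_rtranclp by metis
qed

section \<open>Equational reasoning modulo beta-eta\<close>

lemma equiv_trans [trans]: "s \<approx> t \<Longrightarrow> t \<approx> u \<Longrightarrow> s \<approx> u"
  by (rule equivclp_trans)

lemma equiv_context:
  assumes "s \<approx> t" and step: "\<And>s t. beta_eta s t \<Longrightarrow> beta_eta (f s) (f t)"
  shows "f s \<approx> f t"
  using assms(1)
proof (induction rule: equivclp_induct)
  case (step y z)
  then show ?case using assms(2) by (meson equivclp_into_equivclp)
qed simp

lemma equiv_App: "s \<approx> s' \<Longrightarrow> t \<approx> t' \<Longrightarrow> App s t \<approx> App s' t'"
  using equiv_context[of s s' "\<lambda>s. App s t"] equiv_context[of t t' "App s'"]
  by (blast intro: beta_eta.intros equiv_trans)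

lemma equiv_Abs: "s \<approx> t \<Longrightarrow> Abs s \<approx> Abs t"
  using equiv_context[of s t Abs] by (blast intro: beta_eta.intros)

lemma equiv_funpow_Abs: "s \<approx> t \<Longrightarrow> (Abs ^^ n) s \<approx> (Abs ^^ n) t"
  by (induction n) (auto intro: equiv_Abs)

lemma equiv_foldl_App: "s \<approx> t \<Longrightarrow> foldl App s us \<approx> foldl App t us"
  by (induction us arbitrary: s t) (simp_all add: equiv_App)

lemma lift_foldl_App: "lift (foldl App s ts) k = foldl App (lift s k) (map (\<lambda>t. lift t k) ts)"
  by (induction ts arbitrary: s) auto

lemma upt_0_Suc: "[0..<Suc n] = 0 # map Suc [0..<n]"
  by (simp add: map_Suc_upt upt_conv_Cons del: upt_Suc)

text \<open>Turns an equation for \<open>M\<close> applied to variables into one for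
  \<open>M\<close> itself. The list is reversed because the outermost binder has the largest
  index.\<close>

lemma closed_eta_expansion:
  assumes "\<And>k. lift M k = M"
  shows "M \<approx> (Abs ^^ n) (foldl App M (map Var (rev [0..<n])))"
proof (induction n)
  case (Suc n)
  \<comment> \<open>The new binder is placed innermost: the old variables are lifted and
    \<open>Var 0\<close> is appended, which is an eta redex.\<close>
  have "map Var (rev [0..<Suc n]) = map (\<lambda>t. lift t 0) (map Var (rev [0..<n])) @ [Var 0]"
    unfolding upt_0_Suc by (simp add: rev_map)
  then have "foldl App M (map Var (rev [0..<Suc n])) =
      App (lift (foldl App M (map Var (rev [0..<n]))) 0) (Var 0)"
    by (simp add: lift_foldl_App assms)
  then have "Abs (foldl App M (map Var (rev [0..<Suc n]))) \<approx> foldl App M (map Var (rev [0..<n]))"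
    by (metis beta_eta.eta r_into_equivclp)
  then have "(Abs ^^ Suc n) (foldl App M (map Var (rev [0..<Suc n])))
      \<approx> (Abs ^^ n) (foldl App M (map Var (rev [0..<n])))"
    unfolding funpow_Suc_right o_apply by (rule equiv_funpow_Abs)
  with Suc show ?case by (blast intro: equiv_trans equivclp_sym)
qed simp

section \<open>Trees representing the normal forms\<close>

text \<open>Bodies of normal forms. \<open>Leaf i\<close> is the variable counted from the outermost
  binder, starting at 0, opposite to de Bruijn order.\<close>

datatype tree = Leaf nat | Node tree tree

primrec frontier :: "tree \<Rightarrow> nat list" where
  "frontier (Leaf i) = [i]"
| "frontier (Node l r) = frontier l @ frontier r"

primrec eval_tree :: "(nat \<Rightarrow> lterm) \<Rightarrow> tree \<Rightarrow> lterm" where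
  "eval_tree \<sigma> (Leaf i) = \<sigma> i"
| "eval_tree \<sigma> (Node l r) = App (eval_tree \<sigma> l) (eval_tree \<sigma> r)"

primrec bind_tree :: "(nat \<Rightarrow> tree) \<Rightarrow> tree \<Rightarrow> tree" where
  "bind_tree \<tau> (Leaf i) = \<tau> i"
| "bind_tree \<tau> (Node l r) = Node (bind_tree \<tau> l) (bind_tree \<tau> r)"

primrec args :: "tree \<Rightarrow> tree list" where
  "args (Leaf i) = []"
| "args (Node l r) = args l @ [r]"

abbreviation leaves :: "tree \<Rightarrow> nat" where
  "leaves t \<equiv> length (frontier t)"

abbreviation shift_down :: "tree \<Rightarrow> tree" where
  "shift_down \<equiv> bind_tree (\<lambda>i. Leaf (i - Suc 0))"

lemma frontier_not_Nil [simp]: "frontier t \<noteq> []"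
  by (induction t) auto

lemma spine: "t = foldl Node (Leaf (hd (frontier t))) (args t)"
  by (induction t) auto

lemma eval_bind: "eval_tree \<sigma> (bind_tree \<tau> t) = eval_tree (\<lambda>i. eval_tree \<sigma> (\<tau> i)) t"
  by (induction t) auto

lemma eval_foldl_Node:
  "eval_tree \<sigma> (foldl Node t ts) = foldl App (eval_tree \<sigma> t) (map (eval_tree \<sigma>) ts)"
  by (induction ts arbitrary: t) auto

lemma eval_spine: "eval_tree \<sigma> t = foldl App (\<sigma> (hd (frontier t))) (map (eval_tree \<sigma>) (args t))"
  by (subst spine) (simp add: eval_foldl_Node)

lemma eval_cong:
  "(\<And>i. i \<in> set (frontier t) \<Longrightarrow> \<sigma> i = \<sigma>' i) \<Longrightarrow> eval_tree \<sigma> t = eval_tree \<sigma>' t"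
  by (induction t) auto

lemma frontier_bind: "frontier (bind_tree \<tau> t) = concat (map (\<lambda>i. frontier (\<tau> i)) (frontier t))"
  by (induction t) auto

lemma frontier_shift_down [simp]: "frontier (shift_down t) = map (\<lambda>i. i - 1) (frontier t)"
  by (induction t) auto

lemma frontier_foldl_Node: "frontier (foldl Node t ts) = frontier t @ concat (map frontier ts)"
  by (induction ts arbitrary: t) auto

lemma frontier_spine: "frontier t = hd (frontier t) # concat (map frontier (args t))"
  using frontier_foldl_Node[of "Leaf (hd (frontier t))" "args t"] spine[of t] by simp

lemma args_bind: "args (bind_tree \<tau> t) = args (\<tau> (hd (frontier t))) @ map (bind_tree \<tau>) (args t)"
  by (induction t) auto

lemma size_shift_down [simp]: "size (shift_down t) = size t"
  by (induction t) auto

lemma size_args: "u \<in> set (args t) \<Longrightarrow> size u < size t"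
  by (induction t) auto

lemma length_args_less_leaves: "length (args t) < leaves t"
proof (induction t)
  case (Node l r)
  then show ?case using frontier_not_Nil[of r] by (cases "frontier r") auto
qed auto

text \<open>That the last argument is not a leaf says that the represented body cannot be eta-contracted.\<close>

definition canonical :: "tree \<Rightarrow> bool" where
  "canonical t \<longleftrightarrow> frontier t = [0..<leaves t] \<and> (\<exists>l a b. t = Node l (Node a b))"

lemma canonical_hd: "canonical t \<Longrightarrow> hd (frontier t) = 0"
  unfolding canonical_def using frontier_not_Nil[of t]
  by (metis hd_upt length_greater_0_conv)

text \<open>The head and each argument own at least one leaf, and the last argument owns
  two.\<close>

lemma canonical_length_args:
  assumes "canonical t"
  shows "0 < length (args t)" "length (args t) + 2 \<le> leaves t"
proof -
  obtain l a b where t: "t = Node l (Node a b)" using assms canonical_def by blast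
  have "0 < leaves a" "0 < leaves b" by simp_all
  then show "0 < length (args t)" "length (args t) + 2 \<le> leaves t"
    using length_args_less_leaves[of l] t by (auto simp del: length_greater_0_conv)
qed

lemma frontier_args_canonical:
  assumes "canonical t"
  shows "concat (map frontier (args t)) = [1..<leaves t]"
proof -
  have "0 # concat (map frontier (args t)) = [0..<leaves t]"
    using assms frontier_spine[of t] canonical_hd[OF assms] unfolding canonical_def by simp
  moreover have "0 < leaves t" by simp
  ultimately show ?thesis by (metis One_nat_def list.inject upt_conv_Cons)
qed

text \<open>If \<open>M = \<lambda>x\<^sub>1 \<dots> x\<^sub>n. x\<^sub>1 e\<^sub>1 \<dots> e\<^sub>k\<close> and \<open>N\<close> has \<open>m\<close> binders, then \<open>M N = \<lambda>x\<^sub>2 \<dots> x\<^sub>n. N e\<^sub>1 \<dots> e\<^sub>k\<close>,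
  where the eta-expansion of \<open>N e\<^sub>1 \<dots> e\<^sub>k\<close> supplies \<open>m - k\<close> fresh variables (none if \<open>m \<le> k\<close>, by
  truncated subtraction). \<open>comp_args\<close> lists all arguments passed to \<open>N\<close>, with \<open>x\<^sub>2, x\<^sub>3, \<dots>\<close> renumbered
  from 0.\<close>

definition comp_args :: "tree \<Rightarrow> nat \<Rightarrow> tree list" where
  "comp_args t m = map shift_down (args t) @
     map Leaf [leaves t - 1..<leaves t - 1 + (m - length (args t))]"

text \<open>The list always has at least \<open>leaves f\<close> entries, so \<open>!\<close> stays
  in range. The dropped-off tail is nonempty only if \<open>t\<close> has more arguments than
  \<open>f\<close> has variables.\<close>

definition compose :: "tree \<Rightarrow> tree \<Rightarrow> tree" where
  "compose t f = foldl Node (bind_tree (\<lambda>i. comp_args t (leaves f) ! i) f)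
     (drop (leaves f) (comp_args t (leaves f)))"

lemma length_comp_args: "length (comp_args t m) = length (args t) + (m - length (args t))"
  by (simp add: comp_args_def)

lemma map_nth_upt: "m \<le> length xs \<Longrightarrow> map (\<lambda>i. g (xs ! i)) [0..<m] = map g (take m xs)"
  by (rule nth_equalityI) auto

text \<open>Since \<open>f\<close> uses each variable once and in order, substitution just
  concatenates the frontiers of the arguments, and the fresh variables continue the
  numbering.\<close>

lemma frontier_compose:
  assumes "canonical t" "canonical f"
  shows "frontier (compose t f) = [0..<leaves t - 1 + (leaves f - length (args t))]"
proof -
  let ?m = "leaves f" and ?n = "leaves t"
  let ?ts = "comp_args t ?m"
  have len: "?m \<le> length ?ts" by (simp add: length_comp_args)
  have f: "frontier f = [0..<?m]" using assms(2) canonical_def by blast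
  have "frontier (compose t f) = concat (map (\<lambda>i. frontier (?ts ! i)) [0..<?m])
      @ concat (map frontier (drop ?m ?ts))"
    unfolding compose_def frontier_foldl_Node frontier_bind f[symmetric] ..
  also have "\<dots> = concat (map frontier (take ?m ?ts @ drop ?m ?ts))"
    by (simp only: map_nth_upt[OF len] map_append concat_append)
  also have "\<dots> = concat (map frontier ?ts)" by simp
  also have "\<dots> = map (\<lambda>i. i - 1) (concat (map frontier (args t)))
      @ [?n - 1..<?n - 1 + (?m - length (args t))]"
    by (simp add: comp_args_def map_concat o_def)
  also have "map (\<lambda>i. i - 1) (concat (map frontier (args t))) = [0..<?n - 1]"
    unfolding frontier_args_canonical[OF assms(1)] by (rule nth_equalityI) auto
  also have "[0..<?n - 1] @ [?n - 1..<?n - 1 + (?m - length (args t))]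
      = [0..<?n - 1 + (?m - length (args t))]"
    by (rule upt_add_eq_append[symmetric]) simp
  finally show ?thesis .
qed

text \<open>The last argument comes from that of \<open>f\<close> if nothing is left over, and from
  that of \<open>t\<close> otherwise; substitution keeps either one a \<open>Node\<close>.\<close>

lemma canonical_compose:
  assumes "canonical t" "canonical f"
  shows "canonical (compose t f)"
proof -
  let ?ts = "comp_args t (leaves f)"
  have "\<exists>l a b. compose t f = Node l (Node a b)"
  proof (cases "length (args t) \<le> leaves f")
    case True
    then have "drop (leaves f) ?ts = []" by (simp add: length_comp_args)
    moreover obtain l a b where "f = Node l (Node a b)" using assms(2) canonical_def by blast
    ultimately show ?thesis by (simp add: compose_def)
  next
    case False
    obtain l a b where t: "t = Node l (Node a b)" using assms(1) canonical_def by blast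
    have "?ts = map shift_down (args l) @ [shift_down (Node a b)]"
      using False t by (simp add: comp_args_def)
    then have "drop (leaves f) ?ts = drop (leaves f) (map shift_down (args l)) @ [shift_down (Node a b)]"
      using False t by simp
    then show ?thesis by (simp add: compose_def)
  qed
  then show ?thesis using frontier_compose[OF assms] unfolding canonical_def by simp
qed

text \<open>Arbitrary terms are allowed as values of \<sigma>, so that a \<open>B\<close>-term can
  later be supplied for the head variable.\<close>

definition realizes :: "lterm \<Rightarrow> tree \<Rightarrow> bool" where
  "realizes M t \<longleftrightarrow> (\<forall>\<sigma>. foldl App M (map \<sigma> [0..<leaves t]) \<approx> eval_tree \<sigma> t)"

lemma realizes_compose:
  assumes "canonical t" "canonical f" "realizes M t" "realizes N f"
  shows "realizes (App M N) (compose t f)"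
  unfolding realizes_def
proof
  fix \<sigma>
  let ?m = "leaves f" and ?n = "leaves t"
  let ?ts = "comp_args t ?m"
  let ?r = "?n - 1 + (?m - length (args t))"
  \<comment> \<open>The head variable of \<open>t\<close> receives \<open>N\<close>, and the others
    move down by one.\<close>
  define \<sigma>' where "\<sigma>' = case_nat N \<sigma>"
  have len: "?m \<le> length ?ts" by (simp add: length_comp_args)
  have n: "0 < ?n" by simp
  have upt: "[0..<?r] = [0..<?n - 1] @ [?n - 1..<?r]"
    by (rule upt_add_eq_append) simp
  \<comment> \<open>Leaf 0 occurs only as the head, so \<open>N\<close> does not enter the arguments
    and the truncated decrement in \<open>shift_down\<close> is harmless.\<close>
  have args: "map (eval_tree \<sigma>') (args t) = map (eval_tree \<sigma>) (map shift_down (args t))"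
  proof -
    have "eval_tree \<sigma>' u = eval_tree \<sigma> (shift_down u)" if u: "u \<in> set (args t)" for u
    proof -
      have "set (frontier u) \<subseteq> set (concat (map frontier (args t)))" using u by auto
      then have "\<forall>i \<in> set (frontier u). 1 \<le> i"
        unfolding frontier_args_canonical[OF assms(1)] by auto
      then show ?thesis unfolding eval_bind
        by (intro eval_cong) (auto simp: \<sigma>'_def split: nat.split)
    qed
    then show ?thesis by simp
  qed
  obtain n' where "?n = Suc n'" using n gr0_conv_Suc by blast
  then have "map \<sigma>' [0..<?n] = N # map \<sigma> [0..<?n - 1]"
    by (simp add: \<sigma>'_def upt_0_Suc o_def del: upt_Suc)
  then have "foldl App (App M N) (map \<sigma> [0..<?r])
      = foldl App (foldl App M (map \<sigma>' [0..<?n])) (map \<sigma> [?n - 1..<?r])"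
    unfolding upt by simp
  also have "\<dots> \<approx> foldl App (eval_tree \<sigma>' t) (map \<sigma> [?n - 1..<?r])"
    using assms(3) unfolding realizes_def by (blast intro: equiv_foldl_App)
  also have "foldl App (eval_tree \<sigma>' t) (map \<sigma> [?n - 1..<?r]) = foldl App N (map (eval_tree \<sigma>) ?ts)"
    unfolding eval_spine[of \<sigma>' t] canonical_hd[OF assms(1)] args
    by (simp add: \<sigma>'_def comp_args_def o_def)
  also have "\<dots> = foldl App (foldl App N (map (eval_tree \<sigma>) (take ?m ?ts)))
      (map (eval_tree \<sigma>) (drop ?m ?ts))"
    by (metis append_take_drop_id foldl_append map_append)
  also have "\<dots> = foldl App (foldl App N (map (\<lambda>i. eval_tree \<sigma> (?ts ! i)) [0..<?m]))
      (map (eval_tree \<sigma>) (drop ?m ?ts))"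
    by (simp add: map_nth_upt[OF len])
  also have "\<dots> \<approx> foldl App (eval_tree (\<lambda>i. eval_tree \<sigma> (?ts ! i)) f)
      (map (eval_tree \<sigma>) (drop ?m ?ts))"
    using assms(4) unfolding realizes_def by (blast intro: equiv_foldl_App)
  also have "\<dots> = eval_tree \<sigma> (compose t f)"
    by (simp add: compose_def eval_foldl_Node eval_bind)
  finally show "foldl App (App M N) (map \<sigma> [0..<leaves (compose t f)]) \<approx> eval_tree \<sigma> (compose t f)"
    using frontier_compose[OF assms(1,2)] by simp
qed

section \<open>The tree of a \<open>B\<close>-term\<close>

primrec tree_of :: "bterm \<Rightarrow> tree" where
  "tree_of B = Node (Leaf 0) (Node (Leaf 1) (Leaf 2))"
| "tree_of (BApp Y Z) = compose (tree_of Y) (tree_of Z)"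

lemma canonical_tree_of: "canonical (tree_of Y)"
  by (induction Y) (auto simp: canonical_compose, simp add: canonical_def upt_rec)

lemma B_contraction: "App (App (App (to_lterm B) a) b) c \<approx> App a (App b c)"
proof -
  have "App (to_lterm B) a \<approx> Abs (Abs (App (lift (lift a 0) 0) (App (Var 1) (Var 0))))"
    using beta_eta.beta[of "Abs (Abs (App (Var 2) (App (Var 1) (Var 0))))" a]
    by (intro r_into_equivclp) (simp add: numeral_2_eq_2)
  then have "App (App (App (to_lterm B) a) b) c
      \<approx> App (App (Abs (Abs (App (lift (lift a 0) 0) (App (Var 1) (Var 0))))) b) c"
    by (intro equiv_App) simp_all
  also have "App (Abs (Abs (App (lift (lift a 0) 0) (App (Var 1) (Var 0))))) b
      \<approx> Abs (App (lift a 0) (App (lift b 0) (Var 0)))"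
    using beta_eta.beta[of "Abs (App (lift (lift a 0) 0) (App (Var 1) (Var 0)))" b]
    by (intro r_into_equivclp) (simp flip: lift_subst_ge)
  then have "App (App (Abs (Abs (App (lift (lift a 0) 0) (App (Var 1) (Var 0))))) b) c
      \<approx> App (Abs (App (lift a 0) (App (lift b 0) (Var 0)))) c"
    by (intro equiv_App) simp_all
  also have "\<dots> \<approx> App a (App b c)"
    using beta_eta.beta[of "App (lift a 0) (App (lift b 0) (Var 0))" c]
    by (intro r_into_equivclp) simp
  finally show ?thesis .
qed

lemma realizes_tree_of: "realizes (to_lterm Y) (tree_of Y)"
proof (induction Y)
  case B
  show ?case using B_contraction by (simp add: realizes_def upt_rec numeral_2_eq_2)
next
  case (BApp Y Z)
  then show ?case by (simp add: realizes_compose canonical_tree_of)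
qed

lemma lift_to_lterm: "lift (to_lterm Y) k = to_lterm Y"
  by (induction Y) auto

section \<open>The numbers of binders and arguments\<close>

lemma var_app_eval: "(\<And>i. i \<in> set (frontier t) \<Longrightarrow> \<rho> i < n) \<Longrightarrow> var_app n (eval_tree (\<lambda>i. Var (\<rho> i)) t)"
  by (induction t) (auto intro: var_app.intros)

lemma normal_eval: "beta_eta_normal (eval_tree (\<lambda>i. Var (\<rho> i)) t)"
proof (induction t)
  case (Leaf i)
  show ?case by (auto simp: beta_eta_normal_def elim: beta_eta_VarE)
next
  case (Node l r)
  moreover have "eval_tree (\<lambda>i. Var (\<rho> i)) l \<noteq> Abs s" for s by (cases l) auto
  ultimately show ?case unfolding beta_eta_normal_def
    by (auto elim!: beta_eta_AppE)
qed

lemma normal_Abs: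
  assumes "beta_eta_normal s" "\<And>u. s \<noteq> App u (Var 0)"
  shows "beta_eta_normal (Abs s)"
  using assms unfolding beta_eta_normal_def by (auto elim: beta_eta_AbsE)

lemma normal_funpow_Abs:
  assumes "beta_eta_normal s" "\<And>u. s \<noteq> App u (Var 0)"
  shows "beta_eta_normal ((Abs ^^ n) s)"
proof (induction n)
  case (Suc n)
  moreover have "(Abs ^^ n) s \<noteq> App u (Var 0)" for u using assms(2) by (cases n) auto
  ultimately show ?case by (simp add: normal_Abs)
qed (simp add: assms)

text \<open>Leaf \<open>i\<close> has de Bruijn index \<open>leaves t - 1 - i\<close> under all
  binders. No beta redex occurs in the body, and its last argument, not being a variable, blocks
  eta.\<close>

lemma has_nf_tree_of:
  fixes Y
  defines "t \<equiv> tree_of Y"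
  shows "has_nf Y (leaves t) (map (eval_tree (\<lambda>i. Var (leaves t - 1 - i))) (args t))"
proof -
  let ?n = "leaves t" and ?e = "eval_tree (\<lambda>i. Var (leaves t - 1 - i))"
  have can: "canonical t" unfolding t_def by (rule canonical_tree_of)
  have body: "head_form ?n (map ?e (args t)) = (Abs ^^ ?n) (?e t)"
    using eval_spine[of _ t] canonical_hd[OF can] by (simp add: head_form_def)
  have pos: "0 < ?n" by simp
  have "var_app ?n e" if "e \<in> set (map ?e (args t))" for e
    using that pos by (auto intro!: var_app_eval diff_less)
  moreover have "beta_eta_normal (head_form ?n (map ?e (args t)))"
  proof -
    obtain l a b where "t = Node l (Node a b)" using can canonical_def by blast
    then have "?e t \<noteq> App u (Var 0)" for u by auto
    then show ?thesis unfolding body by (intro normal_funpow_Abs normal_eval)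
  qed
  moreover have "to_lterm Y \<approx> head_form ?n (map ?e (args t))"
  proof -
    have "map Var (rev [0..<?n]) = map (\<lambda>i. Var (?n - 1 - i)) [0..<?n]"
      by (rule nth_equalityI) (auto simp: rev_nth)
    then have "foldl App (to_lterm Y) (map Var (rev [0..<?n])) \<approx> ?e t"
      using realizes_tree_of[of Y] unfolding realizes_def t_def by metis
    then show ?thesis unfolding body
      using closed_eta_expansion[OF lift_to_lterm] equiv_funpow_Abs by (blast intro: equiv_trans)
  qed
  ultimately show ?thesis using pos unfolding has_nf_def by (simp add: Suc_le_eq)
qed

lemma foldl_App_Var_inject: "foldl App (Var a) es = foldl App (Var b) es' \<Longrightarrow> es = es'"
proof (induction es arbitrary: es' rule: rev_induct)
  case Nil
  then show ?case by (cases es' rule: rev_cases) auto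
next
  case (snoc e es)
  then show ?case by (cases es' rule: rev_cases) auto
qed

lemma foldl_App_Var_neq_Abs: "foldl App (Var a) es \<noteq> Abs s"
  by (cases es rule: rev_cases) auto

text \<open>A variable applied to arguments is never an abstraction, so the abstractions can be
  peeled off in parallel.\<close>

lemma funpow_Abs_foldl_inject:
  "(Abs ^^ n) (foldl App (Var a) es) = (Abs ^^ n') (foldl App (Var b) es') \<Longrightarrow> n = n' \<and> es = es'"
proof (induction n arbitrary: n')
  case 0
  then show ?case
    by (cases n') (auto simp: foldl_App_Var_neq_Abs dest: foldl_App_Var_inject)
next
  case (Suc n)
  then show ?case
    by (cases n') (auto simp: foldl_App_Var_neq_Abs[symmetric])
qed

lemma has_nf_unique: "has_nf Y n es \<Longrightarrow> has_nf Y n' es' \<Longrightarrow> n = n' \<and> es = es'"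
  unfolding has_nf_def
  by (metis equivclp_sym equiv_trans normal_form_unique funpow_Abs_foldl_inject head_form_def)

lemma num_binders_eq: "num_binders Y = leaves (tree_of Y)"
  unfolding num_binders_def using has_nf_tree_of[of Y] has_nf_unique by (intro the_equality) blast+

lemma num_args_eq: "num_args Y = length (args (tree_of Y))"
  unfolding num_args_def
proof (rule the_equality)
  show "\<exists>n es. has_nf Y n es \<and> length es = length (args (tree_of Y))"
    using has_nf_tree_of[of Y] by fastforce
  show "k = length (args (tree_of Y))" if "\<exists>n es. has_nf Y n es \<and> length es = k" for k
    using that has_nf_tree_of[of Y] has_nf_unique by (metis length_map)
qed

lemma has_nf_cong: "bterm_equiv Y Z \<Longrightarrow> has_nf Y = has_nf Z"
  by (intro ext) (unfold has_nf_def bterm_equiv_def, blast intro: equiv_trans equivclp_sym)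

lemma num_binders_cong: "bterm_equiv Y Z \<Longrightarrow> num_binders Y = num_binders Z"
  unfolding num_binders_def by (simp add: has_nf_cong)

lemma num_args_cong: "bterm_equiv Y Z \<Longrightarrow> num_args Y = num_args Z"
  unfolding num_args_def by (simp add: has_nf_cong)

section \<open>Repeated self-application\<close>

lemma self_app_Suc: "1 \<le> i \<Longrightarrow> self_app X (Suc i) = BApp (self_app X i) X"
proof -
  assume "1 \<le> i"
  then have "replicate (Suc i - 1) X = replicate (i - 1) X @ [X]"
    by (cases i) (simp_all add: replicate_append_same)
  then show ?thesis by (simp add: self_app_def del: diff_Suc_1)
qed

lemma bterm_equiv_self_app_add:
  assumes "1 \<le> i" "1 \<le> j" "bterm_equiv (self_app X i) (self_app X j)"
  shows "bterm_equiv (self_app X (i + d)) (self_app X (j + d))"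
proof (induction d)
  case (Suc d)
  then show ?case
    using assms(1,2) by (simp add: self_app_Suc bterm_equiv_def equiv_App)
qed (simp add: assms)

text \<open>One repetition makes the sequence periodic, so the class of \<open>self_app X i\<close>
  recurs at arbitrarily large indices.\<close>

lemma bterm_equiv_self_app_mult:
  assumes "1 \<le> i" "bterm_equiv (self_app X i) (self_app X (i + d))"
  shows "bterm_equiv (self_app X i) (self_app X (i + c * d))"
proof (induction c)
  case (Suc c)
  have "bterm_equiv (self_app X (i + c * d)) (self_app X (i + d + c * d))"
    using bterm_equiv_self_app_add[OF assms(1) _ assms(2), of "c * d"] assms(1) by simp
  with Suc show ?case unfolding bterm_equiv_def
    by (metis (no_types, lifting) add.assoc equiv_trans mult_Suc)
qed (simp add: bterm_equiv_def)

text \<open>The head leaf of \<open>f\<close> is replaced by the shifted first argument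
  \<open>e\<close> of \<open>t\<close>, so the arguments of \<open>e\<close> come first in the
  result, and shifting preserves size.\<close>

lemma size_hd_args_compose:
  assumes "canonical t" "canonical f"
    and "length (args t) < leaves f" "length (args (compose t f)) = leaves f - 1"
  shows "size (hd (args (compose t f))) < size (hd (args t))"
proof -
  let ?ts = "comp_args t (leaves f)"
  obtain e es where e: "args t = e # es"
    using canonical_length_args(1)[OF assms(1)] by (cases "args t") auto
  have "drop (leaves f) ?ts = []" using assms(3) by (simp add: length_comp_args)
  moreover have "?ts ! 0 = shift_down e" by (simp add: comp_args_def e)
  ultimately have args: "args (compose t f)
      = args (shift_down e) @ map (bind_tree (\<lambda>i. ?ts ! i)) (args f)"
    using canonical_hd[OF assms(2)] by (simp add: compose_def args_bind)
  \<comment> \<open>\<open>f\<close> supplies at most \<open>leaves f - 2\<close> of the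
    \<open>leaves f - 1\<close> arguments, so \<open>e\<close> must supply one.\<close>
  then have "args (shift_down e) \<noteq> []"
    using assms(4) canonical_length_args(2)[OF assms(2)] by auto
  then have "hd (args (compose t f)) \<in> set (args (shift_down e))" using args by simp
  from size_args[OF this] show ?thesis using e by simp
qed

theorem theorem3p8:
  fixes X :: bterm and T :: "bterm set"
  assumes "\<forall>i\<ge>1. \<exists>X'\<in>T. bterm_equiv (self_app X i) X'"
    and "\<forall>X'\<in>T. int (num_binders X) - int (num_args X') \<ge> 1"
  shows "\<not> rho_property X"
proof
  assume "rho_property X"
  then obtain i j where ij: "1 \<le> i" "i < j" "bterm_equiv (self_app X i) (self_app X j)"
    unfolding rho_property_def bterm_equiv_def by (metis equivclp_sym linorder_neqE_nat)
  define f where "f = tree_of X"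
  define t where "t r = tree_of (self_app X r)" for r
  have can: "canonical f" "canonical (t r)" for r
    by (simp_all add: f_def t_def canonical_tree_of)
  have t_Suc: "t (Suc r) = compose (t r) f" if "1 \<le> r" for r
    using that by (simp add: t_def f_def self_app_Suc)
  have less: "length (args (t r)) < leaves f" if r: "1 \<le> r" for r
  proof -
    from assms(1) r obtain X' where X': "X' \<in> T" "bterm_equiv (self_app X r) X'" by blast
    then have "num_args (self_app X r) < num_binders X"
      using assms(2) num_args_cong[OF X'(2)] by fastforce
    then show ?thesis by (simp add: num_binders_eq num_args_eq t_def f_def)
  qed
  have leaves_Suc: "leaves (t (Suc r)) = leaves (t r) - 1 + (leaves f - length (args (t r)))"
    if "1 \<le> r" for r
    using frontier_compose[OF can(2,1), of r] t_Suc[OF that] by simp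
  have mono: "leaves (t r) \<le> leaves (t s)" if "1 \<le> r" "r \<le> s" for r s
    using that(2)
  proof (induction rule: dec_induct)
    case (step s)
    then show ?case using leaves_Suc[of s] less[of s] that(1) by linarith
  qed simp
  have const: "leaves (t r) = leaves (t i)" if "i \<le> r" for r
  proof (rule antisym)
    \<comment> \<open>After \<open>r\<close> periods the index is at least \<open>r\<close> and the
      binder count is again that at \<open>i\<close>; monotonicity squeezes
      \<open>leaves (t r)\<close> in between.\<close>
    have "bterm_equiv (self_app X i) (self_app X (i + r * (j - i)))"
      using ij by (intro bterm_equiv_self_app_mult) simp_all
    then have "leaves (t i) = leaves (t (i + r * (j - i)))"
      using num_binders_cong num_binders_eq t_def by metis
    moreover have "r * 1 \<le> r * (j - i)" using ij(2) by (intro mult_le_mono2) simp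
    then have "r \<le> i + r * (j - i)" by linarith
    ultimately show "leaves (t r) \<le> leaves (t i)" using mono[of r] ij(1) that by simp
    show "leaves (t i) \<le> leaves (t r)" using mono ij(1) that by simp
  qed
  \<comment> \<open>An unchanged binder count means that exactly one fresh variable replaces the one
    consumed.\<close>
  have len: "length (args (t r)) = leaves f - 1" if r: "i \<le> r" for r
  proof -
    have "1 \<le> r" using r ij(1) by simp
    moreover have "0 < leaves (t r)" by simp
    ultimately show ?thesis using leaves_Suc[of r] const[of r] const[of "Suc r"] less[of r] r by linarith
  qed
  have dec: "size (hd (args (t (Suc r)))) < size (hd (args (t r)))" if r: "i \<le> r" for r
  proof -
    have "1 \<le> r" using r ij(1) by simp
    then show ?thesis
      using size_hd_args_compose[OF can(2,1) less] len[of "Suc r"] t_Suc[of r] r by simp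
  qed
  \<comment> \<open>Each step costs at least one unit of size, so \<open>d\<close> beyond the
    initial size is impossible.\<close>
  have "size (hd (args (t (i + d)))) + d \<le> size (hd (args (t i)))" for d
  proof (induction d)
    case (Suc d)
    then show ?case using dec[of "i + d"] by simp
  qed simp
  from this[of "Suc (size (hd (args (t i))))"] show False by simp
qed

end
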